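(* Let $m,n\ge2$. If $F_m$ has a maximal subgroup isomorphic to $F_n$, then $n\ge m$.
   Context: For $n\ge 2$, $F_n$ is the group of increasing piecewise-linear homeomorphisms of $[0,1]$ with finitely many breakpoints, all in $\mathbb Z[1/n]$, and slopes integer powers of $n$. *)

theory Defs
  imports "HOL-Analysis.Analysis" "HOL-Algebra.Bij"
begin

definition Z_inv :: "nat \<Rightarrow> real set" where
  "Z_inv n = {x. \<exists>(a::int) (k::nat). x = of_int a / of_nat n ^ k}"

definition has_slope_near :: "(real \<Rightarrow> real) \<Rightarrow> real \<Rightarrow> real \<Rightarrow> bool" where
  "has_slope_near f s x \<longleftrightarrow> (\<exists>c. \<forall>\<^sub>F y in nhds x. f y = s * y + c)"

definition breakpoints :: "(real \<Rightarrow> real) \<Rightarrow> real set" where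
  "breakpoints f = {x \<in> {0<..<1}. \<nexists>s. has_slope_near f s x}"

text \<open>
  A continuous function on \<open>[0,1]\<close> is piecewise linear with finitely many breakpoints iff it is
  affine near all but finitely many interior points, so no subdivision of \<open>[0,1]\<close> is mentioned.
  The slopes of \<open>f\<close> are those attained at interior points that are not breakpoints.
  Elements of \<^term>\<open>Bij {0..1::real}\<close> are \<^const>\<open>undefined\<close> outside \<open>[0,1]\<close>; this makes
  the representation of a homeomorphism as a function on all reals unique.
\<close>

definition F_carrier :: "nat \<Rightarrow> (real \<Rightarrow> real) set" where
  "F_carrier n = {f \<in> Bij {0..1}.
     (\<exists>g. homeomorphism {0..1} {0..1} f g) \<and>
     strict_mono_on {0..1} f \<and>
     finite (breakpoints f) \<and>
     breakpoints f \<subseteq> Z_inv n \<and>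
     (\<forall>x\<in>{0<..<1}. \<forall>s. has_slope_near f s x \<longrightarrow> (\<exists>k::int. s = of_nat n powi k))}"

definition F_group :: "nat \<Rightarrow> (real \<Rightarrow> real) monoid" where
  "F_group n = (BijGroup {0..1})\<lparr>carrier := F_carrier n\<rparr>"

definition maximal_subgroup :: "'a set \<Rightarrow> ('a, 'b) monoid_scheme \<Rightarrow> bool" where
  "maximal_subgroup M G \<longleftrightarrow>
     subgroup M G \<and> M \<noteq> carrier G \<and>
     (\<forall>H. subgroup H G \<and> M \<subseteq> H \<longrightarrow> H = M \<or> H = carrier G)"

end

theory Submission
  imports Defs
begin

text \<open>
  A subdivision of \<open>[0,1]\<close> obtained by repeatedly cutting an interval into \<open>n\<close> equal parts is
  encoded by the list of depths of its leaves, a leaf of depth \<open>d\<close> having width \<open>1 / n ^ d\<close>.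
  Every element of \<open>F\<^sub>n\<close> maps the leaves of one such subdivision affinely onto those of a uniform
  one. Moving to right combs shows that \<open>F\<^sub>n\<close> is generated by \<open>n\<close> elements, so the homomorphisms
  from \<open>F\<^sub>n\<close> to the reals form a space of dimension at most \<open>n\<close>. Differences of weighted sums of
  leaf depths give an \<open>m\<close>-dimensional space of homomorphisms from \<open>F\<^sub>m\<close> to the reals. A nonzero
  homomorphism to the reals cannot vanish on a maximal subgroup \<open>M\<close>: it has a value
  \<open>a \<noteq> 0\<close>, and the preimage of \<open>2 a \<int>\<close> would lie strictly between \<open>M\<close> and \<open>F\<^sub>m\<close>. Hence
  restriction of homomorphisms to \<open>M \<cong> F\<^sub>n\<close> is injective, and \<open>m \<le> n\<close>.
\<close>

section \<open>Subdivisions and the maps between them\<close>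

locale n_adic =
  fixes n :: nat
  assumes two_le_n: "2 \<le> n"
begin

definition width :: "nat list \<Rightarrow> real" where
  "width ds = (\<Sum>d\<leftarrow>ds. 1 / real n ^ d)"

text \<open>The leaves are laid end to end from \<open>u\<close> and from \<open>v\<close>. With
  \<open>f u = v\<close> in the base case, the values at both outer end points are forced even for
  empty lists.\<close>

fun leaf_map :: "(real \<Rightarrow> real) \<Rightarrow> real \<Rightarrow> nat list \<Rightarrow> real \<Rightarrow> nat list \<Rightarrow> bool" where
  "leaf_map f u [] v [] \<longleftrightarrow> f u = v"
| "leaf_map f u (d # ds) v (e # es) \<longleftrightarrow>
     (\<forall>t\<in>{0..1}. f (u + t / real n ^ d) = v + t / real n ^ e) \<and>
     leaf_map f (u + 1 / real n ^ d) ds (v + 1 / real n ^ e) es"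
| "leaf_map f u _ v _ \<longleftrightarrow> False"

text \<open>In the language of tree diagrams this hangs an \<open>n\<close>-caret on leaf
  \<open>i\<close>.\<close>

definition expand :: "nat \<Rightarrow> nat list \<Rightarrow> nat list" where
  "expand i ds = take i ds @ replicate n (Suc (ds ! i)) @ drop (Suc i) ds"

inductive tree :: "nat list \<Rightarrow> bool" where
  root: "tree [0]"
| expand: "tree ds \<Longrightarrow> i < length ds \<Longrightarrow> tree (expand i ds)"

lemma n_pos [simp]: "0 < n" "0 < real n" "n \<noteq> 0"
  using two_le_n by auto

lemma width_simps [simp]:
  "width [] = 0" "width (d # ds) = 1 / real n ^ d + width ds"
  "width (xs @ ys) = width xs + width ys" "width (replicate k d) = real k / real n ^ d"
  by (auto simp: width_def sum_list_replicate)

lemma width_nonneg: "0 \<le> width ds"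
  by (induction ds) auto

lemma expand_append [simp]: "expand (length xs) (xs @ d # ys) = xs @ replicate n (Suc d) @ ys"
  by (simp add: expand_def)

lemma length_expand: "i < length ds \<Longrightarrow> length (expand i ds) = length ds + n - 1"
  using two_le_n by (auto simp: expand_def)

lemma width_expand: "i < length ds \<Longrightarrow> width (expand i ds) = width ds"
  by (subst (2) id_take_nth_drop[of i ds]) (simp_all add: expand_def)

text \<open>Splitting leaf \<open>j\<close> puts \<open>n - 1\<close> additional leaves before leaf
  \<open>i\<close>, whence the index \<open>i + n - 1\<close>. The relations among the generators
  come from this commutation.\<close>

lemma expand_expand:
  assumes "j < i" "i < length ds"
  shows "expand j (expand i ds) = expand (i + n - 1) (expand j ds)"
proof -
  define xs where "xs = take j ds"
  define ys where "ys = take (i - j - 1) (drop (Suc j) ds)"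
  define zs where "zs = drop (Suc i) ds"
  have l: "length xs = j" "length ys = i - j - 1"
    using assms by (auto simp: xs_def ys_def)
  have "ds = xs @ ds ! j # drop (Suc j) ds"
    using assms by (simp add: xs_def id_take_nth_drop)
  moreover have "drop (Suc j) ds = ys @ ds ! i # zs"
    using assms id_take_nth_drop[of "i - j - 1" "drop (Suc j) ds"]
    by (simp add: ys_def zs_def)
  ultimately have ds: "ds = xs @ ds ! j # ys @ ds ! i # zs" by simp
  \<comment> \<open>Fresh names for the two entries: rewriting with an equation whose right side
    mentions \<open>ds\<close> would loop.\<close>
  obtain a b where ds: "ds = xs @ a # ys @ b # zs" using ds by blast
  have i: "i = length (xs @ a # ys)" and j: "j = length xs"
    using l assms by auto
  have "expand i ds = (xs @ a # ys) @ replicate n (Suc b) @ zs"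
    unfolding i ds using expand_append[of "xs @ a # ys" b zs] by simp
  moreover have "expand j ds = xs @ replicate n (Suc a) @ ys @ b # zs"
    unfolding j ds by simp
  moreover have "expand (i + n - 1) (xs @ replicate n (Suc a) @ ys @ b # zs) =
      xs @ replicate n (Suc a) @ ys @ replicate n (Suc b) @ zs"
    using expand_append[of "xs @ replicate n (Suc a) @ ys" b zs] i by (simp add: ac_simps)
  ultimately show ?thesis using j by simp
qed

section \<open>Maps that are affine from leaf to leaf\<close>

lemma leaf_map_length: "leaf_map f u ds v es \<Longrightarrow> length ds = length es"
  by (induction f u ds v es rule: leaf_map.induct) auto

lemma leaf_map_start: "leaf_map f u ds v es \<Longrightarrow> f u = v"
  by (cases ds; cases es) (auto dest: bspec[where x = 0])

lemma leaf_map_append: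
  "length xs = length xs' \<Longrightarrow> leaf_map f u (xs @ ys) v (xs' @ ys') \<longleftrightarrow>
     leaf_map f u xs v xs' \<and> leaf_map f (u + width xs) ys (v + width xs') ys'"
proof (induction xs xs' arbitrary: u v rule: list_induct2)
  case Nil
  then show ?case by (auto dest: leaf_map_start)
next
  case (Cons x xs y ys)
  then show ?case by (simp add: add.assoc)
qed

lemma leaf_map_end: "leaf_map f u ds v es \<Longrightarrow> f (u + width ds) = v + width es"
  by (induction f u ds v es rule: leaf_map.induct) (auto simp: add.assoc)

lemma leaf_map_replicate:
  "leaf_map f u (replicate k d) v (replicate k e) \<longleftrightarrow>
     (\<forall>t\<in>{0..real k}. f (u + t / real n ^ d) = v + t / real n ^ e)"
proof (induction k arbitrary: u v)
  case 0
  then show ?case by auto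
next
  case (Suc k)
  \<comment> \<open>The range of \<open>t\<close> is cut where the first leaf ends; the shifted part
    is what the induction hypothesis describes.\<close>
  have *: "{0..real (Suc k)} = {0..1} \<union> (\<lambda>t. 1 + t) ` {0..real k}"
    by (auto simp: image_iff intro!: bexI[where x = "_ - 1"])
  show ?case
    by (simp only: * ball_Un ball_simps replicate_Suc leaf_map.simps Suc)
      (simp add: add_divide_distrib add.assoc)
qed

text \<open>An affine map between two leaves matches the \<open>n\<close> equal parts of one with
  those of the other, as the parameter only gets rescaled to \<open>t / n\<close>.\<close>

lemma leaf_map_expand_aux:
  assumes "leaf_map f u (xs @ d # ys) v (xs' @ e # ys')" "length xs = length xs'"
  shows "leaf_map f u (xs @ replicate n (Suc d) @ ys) v (xs' @ replicate n (Suc e) @ ys')"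
proof -
  have *: "f (u + width xs + t / real n ^ d) = v + width xs' + t / real n ^ e" if "t \<in> {0..1}" for t
    using assms that by (simp add: leaf_map_append)
  have "leaf_map f (u + width xs) (replicate n (Suc d)) (v + width xs') (replicate n (Suc e))"
    unfolding leaf_map_replicate
  proof
    fix t assume "t \<in> {0..real n}"
    then have "t / real n \<in> {0..1}" by (simp add: field_simps)
    from *[OF this] show "f (u + width xs + t / real n ^ Suc d) = v + width xs' + t / real n ^ Suc e"
      by (simp add: field_simps)
  qed
  then show ?thesis using assms by (simp add: leaf_map_append)
qed

lemma leaf_map_expand:
  assumes "leaf_map f u ds v es" "i < length ds"
  shows "leaf_map f u (expand i ds) v (expand i es)"
proof -
  have l: "length ds = length es" using assms leaf_map_length by blast
  have "ds = take i ds @ ds ! i # drop (Suc i) ds" "es = take i es @ es ! i # drop (Suc i) es"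
    using assms l by (simp_all add: id_take_nth_drop)
  then show ?thesis
    unfolding expand_def using assms l
    by (intro leaf_map_expand_aux) auto
qed

lemma leaf_map_cong:
  assumes "leaf_map f u ds v es" "\<And>x. u \<le> x \<Longrightarrow> x \<le> u + width ds \<Longrightarrow> f x = g x"
  shows "leaf_map g u ds v es"
  using assms
proof (induction f u ds v es rule: leaf_map.induct)
  case (2 f u d ds v e es)
  have "g (u + t / real n ^ d) = v + t / real n ^ e" if "t \<in> {0..1}" for t
  proof -
    have "t / real n ^ d \<le> 1 / real n ^ d" using that by (intro divide_right_mono) auto
    then have "f (u + t / real n ^ d) = g (u + t / real n ^ d)"
      using that width_nonneg[of ds] by (intro "2.prems"(2)) auto
    then show ?thesis using 2 that by simp
  qed
  moreover have "leaf_map g (u + 1 / real n ^ d) ds (v + 1 / real n ^ e) es"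
  proof (rule "2.IH")
    fix x assume "u + 1 / real n ^ d \<le> x" "x \<le> u + 1 / real n ^ d + width ds"
    then show "f x = g x" by (intro "2.prems"(2)) (auto intro: order_trans[rotated])
  qed (use 2 in simp)
  ultimately show ?case by simp
qed auto

lemma leaf_map_compose:
  assumes "leaf_map f u ds v es" "leaf_map g v es w fs"
  shows "leaf_map (g \<circ> f) u ds w fs"
  using assms
proof (induction f u ds v es arbitrary: w fs rule: leaf_map.induct)
  case (2 f u d ds v e es)
  then show ?case by (cases fs) auto
next
  case (1 f u v)
  then show ?case by (cases fs) auto
qed auto

lemma leaf_map_ident: "leaf_map (\<lambda>x. x) u ds u ds"
  by (induction ds arbitrary: u) auto

lemma leaf_map_inverse:
  assumes "leaf_map f u ds v es" "\<And>x. u \<le> x \<Longrightarrow> x \<le> u + width ds \<Longrightarrow> g (f x) = x"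
  shows "leaf_map g v es u ds"
proof -
  \<comment> \<open>The pointwise hypothesis on \<open>g\<close> is replaced by
    \<open>leaf_map (g \<circ> f) u ds u ds\<close>, which decomposes along the lists during the
    induction.\<close>
  have "leaf_map (g \<circ> f) u ds u ds \<Longrightarrow> leaf_map f u ds v es \<Longrightarrow> leaf_map g v es u ds"
  proof (induction f u ds v es rule: leaf_map.induct)
    case (2 f u d ds v e es)
    have "g (v + t / real n ^ e) = u + t / real n ^ d" if "t \<in> {0..1}" for t
    proof -
      have "v + t / real n ^ e = f (u + t / real n ^ d)"
        using 2 that by simp
      then show ?thesis using "2.prems"(1) that by simp
    qed
    then show ?case using 2 by simp
  qed auto
  then show ?thesis
    using assms leaf_map_cong[OF leaf_map_ident, of u ds "g \<circ> f"] by auto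
qed

text \<open>The value at the right end of a domain leaf (\<open>t = 1\<close>) reveals the depth of
  its image leaf.\<close>

lemma leaf_map_determines_codomain:
  assumes "leaf_map f u ds v es" "leaf_map f u ds v es'"
  shows "es = es'"
  using assms
proof (induction f u ds v es arbitrary: es' rule: leaf_map.induct)
  case (1 f u v)
  then show ?case by (cases es') auto
next
  case (2 f u d ds v e es)
  then obtain e' es'' where es': "es' = e' # es''" by (cases es') auto
  have "v + 1 / real n ^ e = v + 1 / real n ^ e'"
    using 2 unfolding es' leaf_map.simps by (metis atLeastAtMost_iff order_refl zero_le_one)
  then have "e = e'" using two_le_n by simp
  then show ?case using 2 es' by simp
qed auto

lemma leaf_map_determines_function:
  assumes "leaf_map f u ds v es" "leaf_map g u ds v es" "u \<le> x" "x \<le> u + width ds"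
  shows "f x = g x"
  using assms
proof (induction f u ds v es rule: leaf_map.induct)
  case (2 f u d ds v e es)
  show ?case
  proof (cases "x \<le> u + 1 / real n ^ d")
    case True
    define t where "t = (x - u) * real n ^ d"
    have t: "t \<in> {0..1}" "x = u + t / real n ^ d"
      using True 2 by (auto simp: t_def field_simps)
    then show ?thesis using 2 by simp
  next
    case False
    then show ?thesis using 2 by simp
  qed
qed auto

fun interpolate :: "real \<Rightarrow> nat list \<Rightarrow> real \<Rightarrow> nat list \<Rightarrow> real \<Rightarrow> real" where
  "interpolate u (d # ds) v (e # es) x =
     (if x \<le> u + 1 / real n ^ d then v + (x - u) * real n ^ d / real n ^ e
      else interpolate (u + 1 / real n ^ d) ds (v + 1 / real n ^ e) es x)"
| "interpolate u _ v _ x = v"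

lemma leaf_map_interpolate:
  "length ds = length es \<Longrightarrow> leaf_map (interpolate u ds v es) u ds v es"
proof (induction ds es arbitrary: u v rule: list_induct2)
  case (Cons d ds e es)
  let ?g = "interpolate (u + 1 / real n ^ d) ds (v + 1 / real n ^ e) es"
  have g: "leaf_map ?g (u + 1 / real n ^ d) ds (v + 1 / real n ^ e) es"
    by (rule Cons)
  then have "leaf_map (interpolate u (d # ds) v (e # es)) (u + 1 / real n ^ d) ds (v + 1 / real n ^ e) es"
  proof (rule leaf_map_cong)
    \<comment> \<open>At the common end point the first branch of \<open>interpolate\<close>
      applies; \<open>leaf_map_start\<close> shows that both branches agree there.\<close>
    fix x assume "u + 1 / real n ^ d \<le> x"
    then show "?g x = interpolate u (d # ds) v (e # es) x"
      using leaf_map_start[OF g] by auto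
  qed
  moreover have "\<forall>t\<in>{0..1}. interpolate u (d # ds) v (e # es) (u + t / real n ^ d) = v + t / real n ^ e"
    by (auto simp: divide_right_mono)
  ultimately show ?case by (simp del: interpolate.simps)
qed simp

section \<open>Tree subdivisions and uniform refinements\<close>

lemma tree_width: "tree ds \<Longrightarrow> width ds = 1"
  by (induction rule: tree.induct) (auto simp: width_expand)

lemma tree_length: "tree ds \<Longrightarrow> \<exists>k. length ds = Suc (k * (n - 1))"
proof (induction rule: tree.induct)
  case (expand ds i)
  then obtain k where "length ds = Suc (k * (n - 1))" by blast
  then have "length (expand i ds) = Suc (Suc k * (n - 1))"
    using expand two_le_n by (simp add: length_expand)
  then show ?case by blast
qed auto

text \<open>For total width 1 this bounds the number of leaves by \<open>n ^ L\<close>.\<close>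

lemma width_ge:
  assumes "\<forall>e\<in>set es. e \<le> L"
  shows "real (length es) / real n ^ L \<le> width es"
  using assms
proof (induction es)
  case (Cons e es)
  have "1 / real n ^ L \<le> 1 / real n ^ e"
    using Cons two_le_n by (intro divide_left_mono power_increasing) auto
  then show ?case using Cons by (simp add: add_divide_distrib)
qed simp

text \<open>Repeatedly splitting a leaf of depth below \<open>L\<close> stops at the uniform tree of depth \<open>L\<close>,
  since the number of leaves is bounded by \<open>n ^ L\<close>.\<close>

lemma refine_to_uniform:
  assumes P: "P ds es" "length ds = length es" "width es = 1" "\<forall>e\<in>set es. e \<le> L"
    and step: "\<And>ds es i. P ds es \<Longrightarrow> length ds = length es \<Longrightarrow> i < length es \<Longrightarrow>
      P (expand i ds) (expand i es)"
  shows "\<exists>ds'. length ds' = n ^ L \<and> P ds' (replicate (n ^ L) L)"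
  using P
proof (induction "n ^ L - length es" arbitrary: ds es rule: less_induct)
  case less
  have le: "length es' \<le> n ^ L" if "width es' = 1" "\<forall>e\<in>set es'. e \<le> L" for es'
  proof -
    have "real (length es') \<le> real (n ^ L)"
      using width_ge[OF that(2)] that(1) by (simp add: field_simps)
    then show ?thesis by linarith
  qed
  show ?case
  proof (cases "\<forall>e\<in>set es. e = L")
    case True
    then have es: "es = replicate (length es) L"
      by (simp add: replicate_eqI)
    then have "real (length es) / real n ^ L = 1"
      using less.prems(3) width_simps(4) by metis
    then have "real (length es) = real (n ^ L)" by (simp add: field_simps)
    then have "length es = n ^ L" by linarith
    then show ?thesis using less.prems es by auto
  next
    case False
    then obtain i where i: "i < length es" "es ! i < L"
      using less.prems(4) by (metis in_set_conv_nth le_neq_implies_less)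
    have depth: "\<forall>e\<in>set (expand i es). e \<le> L"
      using less.prems(4) i by (auto simp: expand_def dest: in_set_takeD in_set_dropD)
    have width: "width (expand i es) = 1"
      using less.prems(3) i by (simp add: width_expand)
    have "length es < length (expand i es)"
      using i two_le_n by (simp add: length_expand)
    then have "n ^ L - length (expand i es) < n ^ L - length es"
      using le[OF width depth] by linarith
    then show ?thesis
      using less.hyps[of "expand i es" "expand i ds"] step[of ds es i] i less.prems width depth
      by (simp add: length_expand)
  qed
qed

text \<open>Refinement of the root; the first list is a dummy, and the invariant follows only the
  second.\<close>

lemma tree_uniform: "tree (replicate (n ^ L) L)"
  using refine_to_uniform[of "\<lambda>_ es. tree es" "[0]" "[0]" L] by (auto intro: tree.intros)

end

section \<open>Elements of the group as maps between subdivisions\<close>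

lemma has_slope_near_DERIV: "has_slope_near f s x \<Longrightarrow> (f has_real_derivative s) (at x)"
proof -
  assume "has_slope_near f s x"
  then obtain c where "\<forall>\<^sub>F y in nhds x. f y = s * y + c" by (auto simp: has_slope_near_def)
  moreover have "((\<lambda>y. s * y + c) has_real_derivative s) (at x)"
    by (auto intro!: derivative_eq_intros)
  ultimately show ?thesis by (subst DERIV_cong_ev) auto
qed

lemma has_slope_near_eventually: "has_slope_near f s x \<Longrightarrow> \<forall>\<^sub>F y in nhds x. has_slope_near f s y"
proof -
  assume "has_slope_near f s x"
  then obtain c where "\<forall>\<^sub>F y in nhds x. f y = s * y + c" by (auto simp: has_slope_near_def)
  then have "\<forall>\<^sub>F y in nhds x. \<forall>\<^sub>F z in nhds y. f z = s * z + c"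
    by (simp only: eventually_eventually)
  then show ?thesis by eventually_elim (auto simp: has_slope_near_def)
qed

text \<open>The derivative is locally constant on a connected interval, hence a constant
  \<open>s\<close>. Then \<open>f x - s * x\<close> has derivative 0 inside, and continuity carries
  the formula to the end points.\<close>

lemma affine_if_slopes:
  assumes "a < b" "continuous_on {a..b} f" "\<And>x. x \<in> {a<..<b} \<Longrightarrow> \<exists>s. has_slope_near f s x"
  obtains s where "\<And>x. x \<in> {a<..<b} \<Longrightarrow> has_slope_near f s x"
    and "\<And>x. x \<in> {a..b} \<Longrightarrow> f x = f a + s * (x - a)"
proof -
  have slope: "has_slope_near f (deriv f x) x" if "x \<in> {a<..<b}" for x
    using assms(3)[OF that] has_slope_near_DERIV DERIV_imp_deriv by metis
  define s where "s = deriv f ((a + b) / 2)"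
  have const: "deriv f x = s" if "x \<in> {a<..<b}" for x
    unfolding s_def
  proof (rule connected_local_const[where A = "{a<..<b}" and f = "deriv f"])
    show "\<forall>x\<in>{a<..<b}. \<forall>\<^sub>F y in at x within {a<..<b}. deriv f x = deriv f y"
    proof
      fix x assume "x \<in> {a<..<b}"
      from has_slope_near_eventually[OF slope[OF this]]
      have "\<forall>\<^sub>F y in nhds x. deriv f x = deriv f y"
        by eventually_elim (metis has_slope_near_DERIV DERIV_imp_deriv)
      then show "\<forall>\<^sub>F y in at x within {a<..<b}. deriv f x = deriv f y"
        by (simp add: eventually_at_filter eventually_mono)
    qed
  qed (use that assms(1) in auto)
  have "f x - s * x = f a - s * a" if "x \<in> {a..b}" for x
  proof (rule DERIV_isconst2[where a = a and b = b])
    show "continuous_on {a..b} (\<lambda>x. f x - s * x)"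
      using assms(2) by (intro continuous_intros)
    fix y assume "a < y" "y < b"
    then have "(f has_real_derivative s) (at y)"
      using has_slope_near_DERIV slope const by (metis greaterThanLessThan_iff)
    then show "((\<lambda>x. f x - s * x) has_real_derivative 0) (at y)"
      by (auto intro!: derivative_eq_intros)
  qed (use that assms(1) in auto)
  then show thesis
    using that[of s] slope const by (force simp: algebra_simps)
qed

context n_adic
begin

section \<open>From pairs of subdivisions to group elements\<close>

lemma leaf_map_first_leaf:
  assumes "leaf_map f u (d # ds) v (e # es)" "x \<in> {u..u + 1 / real n ^ d}"
  shows "f x = v + real n powi (int d - int e) * (x - u)"
proof -
  define t where "t = (x - u) * real n ^ d"
  have "t \<in> {0..1}" "x = u + t / real n ^ d"
    using assms(2) by (auto simp: t_def field_simps)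
  then have "f x = v + t / real n ^ e" using assms(1) by simp
  then show ?thesis by (simp add: t_def power_int_diff)
qed

text \<open>Induction glues the affine first leaf \<open>A\<close> to the rest \<open>B\<close> at
  their common point \<open>u'\<close>, where both descriptions give \<open>v'\<close>.\<close>

lemma leaf_map_homeomorphic:
  assumes "leaf_map f u ds v es"
  shows "strict_mono_on {u..u + width ds} f \<and> continuous_on {u..u + width ds} f \<and>
    f ` {u..u + width ds} = {v..v + width es}"
  using assms
proof (induction f u ds v es rule: leaf_map.induct)
  case (1 f u v)
  then show ?case by (simp add: strict_mono_on_def)
next
  case (2 f u d ds v e es)
  define u' where "u' = u + 1 / real n ^ d"
  define v' where "v' = v + 1 / real n ^ e"
  define c where "c = real n powi (int d - int e)"
  define A where "A = {u..u'}"
  define B where "B = {u'..u' + width ds}"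
  have c: "c > 0" "c = real n ^ d / real n ^ e"
    by (auto simp: c_def power_int_diff)
  have lin: "f x = v + c * (x - u)" if "x \<in> A" for x
    using leaf_map_first_leaf[OF "2.prems"] that by (simp add: A_def u'_def c_def)
  have u': "u' \<in> A" "u' \<in> B" "u < u'" using width_nonneg[of ds] by (auto simp: A_def B_def u'_def)
  have IH: "strict_mono_on B f" "continuous_on B f" "f ` B = {v'..v' + width es}"
    using 2 by (simp_all add: u'_def v'_def B_def)
  have fu': "f u' = v'" using lin[OF u'(1)] by (simp add: u'_def v'_def c)
  have AB: "{u..u + width (d # ds)} = A \<union> B"
  proof -
    have "u + width (d # ds) = u' + width ds" by (simp add: u'_def)
    then show ?thesis using u'(3) width_nonneg[of ds] by (auto simp: A_def B_def simp del: width_simps)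
  qed
  have "strict_mono_on (A \<union> B) f"
  proof (rule strict_mono_onI)
    fix x y assume xy: "x \<in> A \<union> B" "y \<in> A \<union> B" "x < y"
    have mA: "f x < f y" if "x \<in> A" "y \<in> A" "x < y" for x y
      using that c(1) by (simp add: lin)
    have mB: "f x < f y" if "x \<in> B" "y \<in> B" "x < y" for x y
      using that IH(1) by (simp add: strict_mono_onD)
    \<comment> \<open>Points on different sides are compared through \<open>u'\<close>.\<close>
    consider "x \<in> A" "y \<in> A" | "x \<in> B" "y \<in> B" | "x \<in> A" "y \<in> B" "x < u'" "u' < y"
      using xy u' by (cases "x = u' \<or> y = u'") (auto simp: A_def B_def)
    then show "f x < f y"
      using mA[of x y] mB[of x y] mA[of x u'] mB[of u' y] u' xy(3) by cases auto
  qed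
  moreover have "continuous_on (A \<union> B) f"
  proof (rule continuous_on_closed_Un)
    show "continuous_on A f"
      by (rule continuous_on_eq[of _ "\<lambda>x. v + c * (x - u)"]) (auto simp: lin intro!: continuous_intros)
  qed (use IH in \<open>auto simp: A_def B_def\<close>)
  moreover have "f ` A = {v..v'}"
  proof
    show "f ` A \<subseteq> {v..v'}"
    proof
      fix y assume "y \<in> f ` A"
      then obtain x where x: "x \<in> A" "y = v + c * (x - u)" using lin by auto
      then have "0 \<le> c * (x - u)" "c * (x - u) \<le> c * (u' - u)"
        using c(1) by (auto simp: A_def)
      moreover have "c * (u' - u) = v' - v" by (simp add: c u'_def v'_def)
      ultimately show "y \<in> {v..v'}" using x by simp
    qed
    show "{v..v'} \<subseteq> f ` A"
    proof
      fix y assume y: "y \<in> {v..v'}"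
      have "(y - v) / c \<le> (v' - v) / c" using y c(1) by (intro divide_right_mono) auto
      moreover have "(v' - v) / c = u' - u" by (simp add: c u'_def v'_def)
      moreover have "0 \<le> (y - v) / c" using y c(1) by simp
      ultimately have "u + (y - v) / c \<in> A" by (simp add: A_def)
      then show "y \<in> f ` A" using lin c(1) by (intro image_eqI[of _ _ "u + (y - v) / c"]) auto
    qed
  qed
  then have "f ` (A \<union> B) = {v..v + width (e # es)}"
    using width_nonneg[of es] IH(3)
    by (simp add: image_Un v'_def ivl_disj_un_two_touch add.assoc)
  ultimately show ?case by (simp only: AB)
qed auto

text \<open>Only the right side of \<open>x\<close> is described, so that leaf boundaries need no
  separate treatment.\<close>

lemma leaf_map_right_slope:
  assumes "leaf_map f u ds v es" "u \<le> x" "x < u + width ds"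
  shows "\<exists>(k::int) b. x < b \<and> (\<forall>y\<in>{x..b}. f y = f x + real n powi k * (y - x))"
  using assms
proof (induction f u ds v es rule: leaf_map.induct)
  case (2 f u d ds v e es)
  show ?case
  proof (cases "x < u + 1 / real n ^ d")
    case True
    show ?thesis
    proof (intro exI conjI ballI)
      fix y assume "y \<in> {x..u + 1 / real n ^ d}"
      then show "f y = f x + real n powi (int d - int e) * (y - x)"
        using leaf_map_first_leaf[OF "2.prems"(1), of x] leaf_map_first_leaf[OF "2.prems"(1), of y]
          "2.prems"(2) by (simp add: right_diff_distrib)
    qed (fact True)
  next
    case False
    then show ?thesis using 2 by simp
  qed
qed auto

lemma Z_inv_add: "u \<in> Z_inv n \<Longrightarrow> u + 1 / real n ^ d \<in> Z_inv n"
proof -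
  assume "u \<in> Z_inv n"
  then obtain a k where "u = of_int a / real n ^ k" unfolding Z_inv_def by blast
  then have "u + 1 / real n ^ d = of_int (a * int n ^ d + int n ^ k) / real n ^ (k + d)"
    by (simp add: field_simps power_add)
  then show ?thesis unfolding Z_inv_def by blast
qed

text \<open>The exceptional set collects the right end points of the leaves.\<close>

lemma leaf_map_slopes:
  assumes "leaf_map f u ds v es" "u \<in> Z_inv n"
  shows "\<exists>P. finite P \<and> P \<subseteq> Z_inv n \<and>
    (\<forall>x\<in>{u<..<u + width ds} - P. \<exists>s. has_slope_near f s x)"
  using assms
proof (induction f u ds v es rule: leaf_map.induct)
  case (1 f u v)
  then show ?case by (intro exI[of _ "{}"]) auto
next
  case (2 f u d ds v e es)
  define u' where "u' = u + 1 / real n ^ d"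
  have u': "u' \<in> Z_inv n" unfolding u'_def using 2 by (intro Z_inv_add)
  then obtain P where P: "finite P" "P \<subseteq> Z_inv n"
      "\<And>x. x \<in> {u'<..<u' + width ds} - P \<Longrightarrow> \<exists>s. has_slope_near f s x"
    using 2 by (auto simp: u'_def)
  have "\<exists>s. has_slope_near f s x" if x: "x \<in> {u<..<u + width (d # ds)} - insert u' P" for x
  proof (cases "x < u'")
    case True
    let ?s = "real n powi (int d - int e)"
    have "\<forall>\<^sub>F y in nhds x. y \<in> {u<..<u'}"
      using True x by (intro eventually_nhds_in_open) auto
    then have "\<forall>\<^sub>F y in nhds x. f y = ?s * y + (v - ?s * u)"
    proof eventually_elim
      case (elim y)
      then have "f y = v + ?s * (y - u)" unfolding u'_def by (intro leaf_map_first_leaf[OF "2.prems"(1)]) auto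
      then show ?case by (simp add: algebra_simps)
    qed
    then show ?thesis unfolding has_slope_near_def by blast
  next
    case False
    then show ?thesis using x by (intro P) (auto simp: u'_def)
  qed
  then show ?case using P u' by (intro exI[of _ "insert u' P"]) auto
qed auto

lemma leaf_map_imp_F_carrier:
  assumes "f \<in> extensional {0..1}" "leaf_map f 0 ds 0 es" "width ds = 1" "width es = 1"
  shows "f \<in> F_carrier n"
proof -
  have f: "strict_mono_on {0..1} f" "continuous_on {0..1} f" "f ` {0..1} = {0..1}"
    using leaf_map_homeomorphic[OF assms(2)] assms(3,4) by simp_all
  have inj: "inj_on f {0..1}" using f(1) by (rule strict_mono_on_imp_inj_on)
  have "0 \<in> Z_inv n" unfolding Z_inv_def by (rule CollectI, rule exI[of _ 0]) simp
  from leaf_map_slopes[OF assms(2) this] obtain P where P: "finite P" "P \<subseteq> Z_inv n"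
      "\<forall>x\<in>{0<..<1} - P. \<exists>s. has_slope_near f s x"
    using assms(3) by auto
  then have bp: "breakpoints f \<subseteq> P" unfolding breakpoints_def by blast
  have slope: "\<exists>k::int. s = real n powi k" if x: "x \<in> {0<..<1}" and s: "has_slope_near f s x" for x s
  proof -
    obtain k b where kb: "x < b" "\<And>y. y \<in> {x..b} \<Longrightarrow> f x + real n powi k * (y - x) = f y"
      using leaf_map_right_slope[OF assms(2), of x] x unfolding assms(3)
      by (metis add_0 greaterThanLessThan_iff less_imp_le)
    \<comment> \<open>The derivative from the right is \<open>s\<close> by local affinity at
      \<open>x\<close>, and a power of \<open>n\<close> by the leaf to the right; it is unique since
      \<open>x\<close> is a limit point of \<open>{x..b}\<close>.\<close>
    have "(f has_real_derivative s) (at x within {x..b})"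
      using has_slope_near_DERIV[OF s] by (rule has_field_derivative_at_within)
    moreover have "((\<lambda>y. f x + real n powi k * (y - x)) has_real_derivative real n powi k) (at x within {x..b})"
      by (auto intro!: derivative_eq_intros)
    then have "(f has_real_derivative real n powi k) (at x within {x..b})"
      by (rule has_field_derivative_transform_within[where d = 1]) (use kb in simp_all)
    moreover have "at x within {x..b} \<noteq> bot"
      using kb(1) by (simp add: trivial_limit_within islimpt_Icc)
    ultimately show ?thesis using has_field_derivative_unique by blast
  qed
  show ?thesis
    unfolding F_carrier_def Bij_def bij_betw_def
    using assms(1) f inj homeomorphism_compact[OF compact_Icc f(2) f(3) inj] bp P slope
    by (auto intro: finite_subset)
qed

section \<open>From group elements to pairs of subdivisions\<close>

lemma F_carrier_homeo:
  assumes "f \<in> F_carrier n"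
  shows "f 0 = 0" "f 1 = 1" "continuous_on {0..1} f" "f ` {0..1} = {0..1}"
proof -
  have 2: "strict_mono_on {0..1} f" using assms by (simp add: F_carrier_def)
  show 1: "f ` {0..1} = {0..1}" and "continuous_on {0..1} f"
    using assms by (auto simp: F_carrier_def Bij_def bij_betw_def homeomorphism_def)
  have mono: "f x \<le> f y" if "x \<in> {0..1}" "y \<in> {0..1}" "x \<le> y" for x y
    using 2 that by (metis order_le_less strict_mono_onD)
  obtain a b where a: "a \<in> {0..1}" "f a = 0" and b: "b \<in> {0..1}" "f b = 1"
    using 1 by (metis (no_types, opaque_lifting) atLeastAtMost_iff imageE order_refl zero_le_one)
  have "f 0 \<in> {0..1}" "f 1 \<in> {0..1}" using 1 by auto
  then show "f 0 = 0" "f 1 = 1" using mono[of 0 a] mono[of b 1] a b by auto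
qed

lemma finite_Z_inv_common_denominator:
  assumes "finite P" "P \<subseteq> Z_inv n"
  shows "\<exists>k. \<forall>x\<in>P. \<exists>a::int. x = of_int a / real n ^ k"
  using assms
proof (induction P)
  case (insert x P)
  then obtain k where k: "\<forall>x\<in>P. \<exists>a::int. x = of_int a / real n ^ k" by auto
  obtain b l where x: "x = of_int b / real n ^ l" using insert unfolding Z_inv_def by auto
  have raise: "of_int a / real n ^ i = of_int (a * int n ^ j) / real n ^ (i + j)" for a i j
    by (simp add: power_add)
  show ?case
  proof (intro exI[of _ "k + l"] ballI)
    fix y assume "y \<in> insert x P"
    then show "\<exists>a::int. y = of_int a / real n ^ (k + l)"
      using k x raise by (metis add.commute insertE)
  qed
qed simp

text \<open>A grid of mesh \<open>1 / n ^ k\<close> containing all breakpoints makes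
  \<open>f\<close> affine on each cell, with a slope that is a power of \<open>n\<close>.\<close>

lemma F_carrier_leaf_map_grid:
  assumes "f \<in> F_carrier n"
  shows "\<exists>k es. leaf_map f 0 (replicate (n ^ k) k) 0 es \<and> width es = 1"
proof -
  note f = F_carrier_homeo[OF assms]
  have "finite (breakpoints f)" "breakpoints f \<subseteq> Z_inv n"
    using assms by (simp_all add: F_carrier_def)
  from finite_Z_inv_common_denominator[OF this]
  obtain k where k: "\<And>x. x \<in> breakpoints f \<Longrightarrow> \<exists>a::int. x = of_int a / real n ^ k" by blast
  define p where "p j = real j / real n ^ k" for j
  have p_Suc: "p (Suc j) = p j + 1 / real n ^ k" for j by (simp add: p_def add_divide_distrib)
  have ex: "\<exists>e. \<forall>x\<in>{p j..p (Suc j)}. f x = f (p j) + real n ^ k / real n ^ e * (x - p j)"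
    if j: "j < n ^ k" for j
  proof -
    have p: "p j < p (Suc j)" "0 \<le> p j" by (simp_all add: p_Suc) (simp add: p_def)
    have "real (Suc j) \<le> real (n ^ k)" using j by (intro of_nat_mono) simp
    then have p1: "p (Suc j) \<le> 1" by (simp add: p_def field_simps)
    have inside: "x \<in> {0<..<1}" if "x \<in> {p j<..<p (Suc j)}" for x
      using that p p1 by auto
    have "x \<notin> breakpoints f" if "x \<in> {p j<..<p (Suc j)}" for x
    proof
      assume "x \<in> breakpoints f"
      then obtain a :: int where a: "x = of_int a / real n ^ k" using k by blast
      then have "of_int (int j) < (of_int a :: real)" "of_int a < (of_int (int j + 1) :: real)"
        using that by (auto simp: p_def divide_less_cancel)
      \<comment> \<open>A breakpoint inside the cell would be a grid point, giving an integer
        strictly between \<open>j\<close> and \<open>j + 1\<close>.\<close>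
      then have "int j < a \<and> a < int j + 1" by (simp only: of_int_less_iff)
      then show False by linarith
    qed
    then have slopes: "\<exists>s. has_slope_near f s x" if "x \<in> {p j<..<p (Suc j)}" for x
      using that inside[OF that] by (simp add: breakpoints_def)
    have "continuous_on {p j..p (Suc j)} f"
      using f(3) by (rule continuous_on_subset) (use p p1 in auto)
    from affine_if_slopes[OF p(1) this slopes] obtain s
      where s: "\<And>x. x \<in> {p j<..<p (Suc j)} \<Longrightarrow> has_slope_near f s x"
        and lin: "\<And>x. x \<in> {p j..p (Suc j)} \<Longrightarrow> f x = f (p j) + s * (x - p j)" by metis
    obtain x where x: "x \<in> {p j<..<p (Suc j)}" using p(1) dense by auto
    have "\<forall>x\<in>{0<..<1}. \<forall>s. has_slope_near f s x \<longrightarrow> (\<exists>i::int. s = real n powi i)"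
      using assms by (simp add: F_carrier_def)
    then obtain i :: int where i: "s = real n powi i"
      using s[OF x] inside[OF x] by blast
    \<comment> \<open>The image of the cell fits into \<open>[0,1]\<close>, so the slope
      \<open>n powi i\<close> has \<open>i \<le> k\<close>, and the image has width
      \<open>1 / n ^ (k - i)\<close> with a natural exponent.\<close>
    have "f (p (Suc j)) \<le> 1" "0 \<le> f (p j)" using f(4) p p1 by auto
    moreover have "f (p (Suc j)) = f (p j) + s * (1 / real n ^ k)"
      using lin[of "p (Suc j)"] p by (simp add: p_Suc)
    ultimately have "s * (1 / real n ^ k) \<le> 1" by linarith
    then have "real n powi i \<le> real n powi int k" by (simp add: i field_simps)
    then have "i \<le> int k"
      using two_le_n power_int_strict_increasing[of "int k" i "real n"] by linarith
    then have "real n ^ nat (int k - i) = real n powi (int k - i)"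
      by (simp add: power_int_def)
    then have "s = real n ^ k / real n ^ nat (int k - i)"
      by (simp add: i power_int_diff)
    then show ?thesis using lin by blast
  qed
  then obtain e where e: "\<And>j x. j < n ^ k \<Longrightarrow> x \<in> {p j..p (Suc j)} \<Longrightarrow>
      f x = f (p j) + real n ^ k / real n ^ e j * (x - p j)" by metis
  have "J \<le> n ^ k \<Longrightarrow> leaf_map f 0 (replicate J k) 0 (map e [0..<J])" for J
  proof (induction J)
    case 0
    then show ?case using f(1) by simp
  next
    case (Suc J)
    then have IH: "leaf_map f 0 (replicate J k) 0 (map e [0..<J])" by simp
    define w where "w = width (map e [0..<J])"
    have w: "f (p J) = w" using leaf_map_end[OF IH] by (simp add: p_def w_def)
    have "f (p J + t / real n ^ k) = w + t / real n ^ e J" if "t \<in> {0..1}" for t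
      using e[of J "p J + t / real n ^ k"] Suc.prems that w
      by (simp add: p_Suc divide_right_mono)
    moreover from this[of 1] have "f (p J + 1 / real n ^ k) = w + 1 / real n ^ e J" by simp
    ultimately have "leaf_map f (p J) [k] w [e J]" by simp
    then have "leaf_map f 0 (replicate J k @ [k]) 0 (map e [0..<J] @ [e J])"
      using IH by (simp only: leaf_map_append length_replicate length_map length_upt) (simp add: p_def w_def)
    then show ?case by (simp add: replicate_append_same)
  qed
  from this[of "n ^ k"] have lm: "leaf_map f 0 (replicate (n ^ k) k) 0 (map e [0..<n ^ k])" by simp
  then have "width (map e [0..<n ^ k]) = 1" using leaf_map_end f(2) by fastforce
  then show ?thesis using lm by blast
qed

text \<open>Refining the image list to a uniform one refines the domain along with it, and the
  domain starts as a uniform tree, so it stays a tree. Having this for all large \<open>L\<close>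
  lets two elements share a level.\<close>

lemma F_carrier_leaf_map_uniform:
  assumes "f \<in> F_carrier n"
  shows "\<exists>L0. \<forall>L\<ge>L0. \<exists>ds. tree ds \<and> leaf_map f 0 ds 0 (replicate (n ^ L) L)"
proof -
  obtain k es where es: "leaf_map f 0 (replicate (n ^ k) k) 0 es" "width es = 1"
    using F_carrier_leaf_map_grid[OF assms] by blast
  let ?P = "\<lambda>ds es. tree ds \<and> leaf_map f 0 ds 0 es"
  \<comment> \<open>\<open>sum_list es\<close> serves as a crude bound for every depth in
    \<open>es\<close>.\<close>
  have "\<exists>ds. length ds = n ^ L \<and> ?P ds (replicate (n ^ L) L)" if L: "sum_list es \<le> L" for L
  proof (rule refine_to_uniform[of ?P, OF _ leaf_map_length[OF es(1)] es(2)])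
    show "?P (replicate (n ^ k) k) es" using es(1) tree_uniform by blast
    show "\<forall>e\<in>set es. e \<le> L"
    proof
      fix e assume "e \<in> set es"
      then have "e \<le> sum_list es" by (intro member_le_sum_list) simp_all
      then show "e \<le> L" using L by (rule order_trans)
    qed
    show "?P (expand i ds) (expand i es)" if "?P ds es" "length ds = length es" "i < length es" for ds es i
      using that tree.expand[of ds i] leaf_map_expand[of f 0 ds 0 es i] by simp
  qed
  then show ?thesis by blast
qed

end

section \<open>The group structure and its generators\<close>

context n_adic
begin

section \<open>Group operations on pairs of subdivisions\<close>

lemma leaf_map_restrict:
  assumes "leaf_map f 0 ds 0 es" "width ds = 1"
  shows "leaf_map (restrict f {0..1}) 0 ds 0 es"
  using assms by (intro leaf_map_cong[OF assms(1)]) auto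

lemma F_carrier_realize:
  assumes "length ds = length es" "width ds = 1" "width es = 1"
  shows "\<exists>f\<in>F_carrier n. leaf_map f 0 ds 0 es"
  using leaf_map_restrict[OF leaf_map_interpolate[OF assms(1)] assms(2)] assms
    leaf_map_imp_F_carrier restrict_extensional by blast

lemma F_carrier_eqI:
  assumes "f \<in> F_carrier n" "g \<in> F_carrier n" "leaf_map f 0 ds 0 es" "leaf_map g 0 ds 0 es" "width ds = 1"
  shows "f = g"
proof (rule extensionalityI[where A = "{0..1}"])
  show "f \<in> extensional {0..1}" "g \<in> extensional {0..1}"
    using assms(1,2) by (simp_all add: F_carrier_def Bij_def)
  fix x :: real assume "x \<in> {0..1}"
  then show "f x = g x"
    using leaf_map_determines_function[OF assms(3,4)] assms(5) by simp
qed

lemma F_carrier_Bij: "f \<in> F_carrier n \<Longrightarrow> f \<in> Bij {0..1}"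
  by (simp add: F_carrier_def)

lemma leaf_map_m_inv_BijGroup:
  assumes "f \<in> Bij {0..1}" "leaf_map f 0 ds 0 es" "width ds = 1" "width es = 1"
  shows "leaf_map (m_inv (BijGroup {0..1}) f) 0 es 0 ds"
proof -
  have "leaf_map (inv_into {0..1} f) 0 es 0 ds"
    using assms by (intro leaf_map_inverse[OF assms(2)]) (auto simp: Bij_def bij_betw_def)
  then show ?thesis using leaf_map_restrict assms by (simp add: inv_BijGroup)
qed

lemma leaf_map_mult_BijGroup:
  assumes "f \<in> Bij {0..1}" "g \<in> Bij {0..1}" "leaf_map f 0 ds 0 es" "leaf_map g 0 es 0 fs" "width ds = 1"
  shows "leaf_map (g \<otimes>\<^bsub>BijGroup {0..1}\<^esub> f) 0 ds 0 fs"
proof -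
  have "g \<otimes>\<^bsub>BijGroup {0..1}\<^esub> f = restrict (g \<circ> f) {0..1}"
    using assms(1,2) by (simp add: BijGroup_def compose_def o_def)
  then show ?thesis using leaf_map_restrict[OF leaf_map_compose[OF assms(3,4)] assms(5)] by simp
qed

lemma F_carrier_m_inv_BijGroup:
  assumes "f \<in> F_carrier n"
  shows "m_inv (BijGroup {0..1}) f \<in> F_carrier n"
proof -
  obtain L ds where f: "tree ds" "leaf_map f 0 ds 0 (replicate (n ^ L) L)"
    using F_carrier_leaf_map_uniform[OF assms] by blast
  have "m_inv (BijGroup {0..1}) f \<in> extensional {0..1}"
    using inv_BijGroup[OF F_carrier_Bij[OF assms]] by simp
  moreover have "leaf_map (m_inv (BijGroup {0..1}) f) 0 (replicate (n ^ L) L) 0 ds"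
    using f tree_width assms F_carrier_Bij by (intro leaf_map_m_inv_BijGroup) simp_all
  ultimately show ?thesis
    using tree_width[OF f(1)] tree_width[OF tree_uniform[of L]] by (intro leaf_map_imp_F_carrier)
qed

text \<open>The previous description is applied to the inverse, whose pair of subdivisions is then
  swapped.\<close>

lemma F_carrier_leaf_map_from_uniform:
  assumes "f \<in> F_carrier n"
  shows "\<exists>L0. \<forall>L\<ge>L0. \<exists>ds. tree ds \<and> leaf_map f 0 (replicate (n ^ L) L) 0 ds"
proof -
  let ?g = "m_inv (BijGroup {0..1}) f"
  have f: "f \<in> Bij {0..1}" and g: "?g \<in> Bij {0..1}"
    using assms F_carrier_m_inv_BijGroup F_carrier_Bij by blast+
  have "m_inv (BijGroup {0..1}) ?g = f"
    using group.inv_inv[OF group_BijGroup] f by (simp add: BijGroup_def)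
  then have "leaf_map f 0 (replicate (n ^ L) L) 0 ds"
    if "tree ds" "leaf_map ?g 0 ds 0 (replicate (n ^ L) L)" for L ds
    using leaf_map_m_inv_BijGroup[OF g that(2)] tree_width[OF that(1)] by simp
  then show ?thesis
    using F_carrier_leaf_map_uniform[OF F_carrier_m_inv_BijGroup[OF assms]] by metis
qed

text \<open>One high level serves as the target of \<open>f\<close> and the source of
  \<open>g\<close>, so that the product runs from \<open>ds\<close> to \<open>es\<close>.\<close>

lemma F_carrier_common_uniform:
  assumes "f \<in> F_carrier n" "g \<in> F_carrier n"
  obtains L ds es where "tree ds" "tree es"
    "leaf_map f 0 ds 0 (replicate (n ^ L) L)" "leaf_map g 0 (replicate (n ^ L) L) 0 es"
proof -
  obtain L0 L1
    where L0: "\<forall>L\<ge>L0. \<exists>ds. tree ds \<and> leaf_map f 0 ds 0 (replicate (n ^ L) L)"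
      and L1: "\<forall>L\<ge>L1. \<exists>es. tree es \<and> leaf_map g 0 (replicate (n ^ L) L) 0 es"
    using F_carrier_leaf_map_uniform[OF assms(1)] F_carrier_leaf_map_from_uniform[OF assms(2)] by blast
  from L0[rule_format, OF max.cobounded1[of L0 L1]] L1[rule_format, OF max.cobounded2[of L1 L0]]
  show thesis by (elim exE conjE) (rule that)
qed

lemma subgroup_F_carrier: "subgroup (F_carrier n) (BijGroup {0..1})"
proof (rule subgroup.intro)
  show "F_carrier n \<subseteq> carrier (BijGroup {0..1})"
    using F_carrier_Bij by (auto simp: BijGroup_def)
  show "\<one>\<^bsub>BijGroup {0..1}\<^esub> \<in> F_carrier n"
    unfolding BijGroup_def monoid.select_convs
    by (rule leaf_map_imp_F_carrier[OF _ leaf_map_restrict[OF leaf_map_ident[of 0 "[0]"]]]) simp_all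
  show "m_inv (BijGroup {0..1}) f \<in> F_carrier n" if "f \<in> F_carrier n" for f
    using that by (rule F_carrier_m_inv_BijGroup)
  show "g \<otimes>\<^bsub>BijGroup {0..1}\<^esub> f \<in> F_carrier n" if gf: "g \<in> F_carrier n" "f \<in> F_carrier n" for g f
  proof -
    have B: "f \<in> Bij {0..1}" "g \<in> Bij {0..1}" using gf F_carrier_Bij by blast+
    obtain L ds es where *: "tree ds" "tree es"
      "leaf_map f 0 ds 0 (replicate (n ^ L) L)" "leaf_map g 0 (replicate (n ^ L) L) 0 es"
      using F_carrier_common_uniform[OF gf(2,1)] .
    have "g \<otimes>\<^bsub>BijGroup {0..1}\<^esub> f \<in> extensional {0..1}"
      using B by (simp add: BijGroup_def compose_def)
    then show ?thesis
      using leaf_map_mult_BijGroup[OF B *(3,4)] tree_width[OF *(1)] tree_width[OF *(2)]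
      by (intro leaf_map_imp_F_carrier)
  qed
qed

lemma group_F_group: "group (F_group n)"
  unfolding F_group_def by (rule subgroup.subgroup_is_group[OF subgroup_F_carrier group_BijGroup])

lemma carrier_F_group [simp]: "carrier (F_group n) = F_carrier n"
  by (simp add: F_group_def)

lemma leaf_map_one: "width ds = 1 \<Longrightarrow> leaf_map \<one>\<^bsub>F_group n\<^esub> 0 ds 0 ds"
  using leaf_map_restrict[OF leaf_map_ident] by (simp add: F_group_def BijGroup_def)

lemma leaf_map_mult:
  assumes "f \<in> F_carrier n" "g \<in> F_carrier n" "leaf_map f 0 ds 0 es" "leaf_map g 0 es 0 fs" "width ds = 1"
  shows "leaf_map (g \<otimes>\<^bsub>F_group n\<^esub> f) 0 ds 0 fs"
  using leaf_map_mult_BijGroup[OF _ _ assms(3-5)] assms(1,2) F_carrier_Bij by (simp add: F_group_def)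

lemma leaf_map_m_inv:
  assumes "f \<in> F_carrier n" "leaf_map f 0 ds 0 es" "width ds = 1" "width es = 1"
  shows "leaf_map (inv\<^bsub>F_group n\<^esub> f) 0 es 0 ds"
  using leaf_map_m_inv_BijGroup[OF _ assms(2-4)] assms(1) F_carrier_Bij
    group.m_inv_consistent[OF group_BijGroup subgroup_F_carrier assms(1)]
  by (simp add: F_group_def)

section \<open>Right combs and a generating set of \<open>n\<close> elements\<close>

primrec comb :: "nat \<Rightarrow> nat list" where
  "comb 0 = [0]"
| "comb (Suc k) = expand (k * (n - 1)) (comb k)"

lemma length_comb [simp]: "length (comb k) = Suc (k * (n - 1))"
  using two_le_n by (induction k) (simp_all add: length_expand)

lemma tree_comb: "tree (comb k)"
  by (induction k) (auto intro: tree.intros)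

lemma width_expand_comb: "i \<le> k * (n - 1) \<Longrightarrow> width (expand i (comb k)) = 1"
  by (intro tree_width tree.expand tree_comb) simp

text \<open>\<open>comb (Suc k)\<close> splits the last leaf of \<open>comb k\<close>, which has
  index \<open>k * (n - 1)\<close>. An earlier split at \<open>i\<close> moves that leaf to index
  \<open>Suc k * (n - 1)\<close>.\<close>

lemma expand_comb_Suc:
  assumes "i < k * (n - 1)"
  shows "expand i (comb (Suc k)) = expand (Suc k * (n - 1)) (expand i (comb k))"
  using expand_expand[of i "k * (n - 1)" "comb k"] assms two_le_n by (simp add: add.commute)

text \<open>Splitting the last leaf on both sides shows that the same map works one level
  higher.\<close>

lemma leaf_map_comb_Suc:
  assumes "i < k * (n - 1)" "leaf_map f 0 (expand i (comb k)) 0 (comb (Suc k))"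
  shows "leaf_map f 0 (expand i (comb (Suc k))) 0 (comb (Suc (Suc k)))"
proof -
  have "Suc k * (n - 1) < length (expand i (comb k))"
    using assms(1) two_le_n by (simp add: length_expand)
  from leaf_map_expand[OF assms(2) this] show ?thesis
    by (simp only: expand_comb_Suc[OF assms(1)] comb.simps(2)[of "Suc k"])
qed

text \<open>The map taking the expansion of \<open>comb k\<close> at leaf \<open>i\<close> to \<open>comb (Suc k)\<close> does not depend on
  \<open>k\<close>; call it \<open>x i\<close>. Splitting the leaves \<open>0 < i\<close> in both orders gives
  \<open>x (i + n - 1) = x 0 \<otimes> x i \<otimes> inv (x 0)\<close>, so \<open>x 0, \<dots>, x (n - 1)\<close> suffice.\<close>

lemma expand_comb_to_comb:
  assumes K: "subgroup K (F_group n)"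
    and gen1: "\<And>i. i < n - 1 \<Longrightarrow> \<exists>f\<in>K. leaf_map f 0 (expand i (comb 1)) 0 (comb 2)"
    and gen2: "\<exists>f\<in>K. leaf_map f 0 (expand (n - 1) (comb 2)) 0 (comb 3)"
  shows "i \<le> k * (n - 1) \<Longrightarrow> \<exists>f\<in>K. leaf_map f 0 (expand i (comb k)) 0 (comb (Suc k))"
proof (induction k arbitrary: i)
  case 0
  then show ?case
    using leaf_map_one[OF width_expand_comb[of 0 0]] subgroup.one_closed[OF K] by auto
next
  case (Suc k)
  have KF: "f \<in> F_carrier n" if "f \<in> K" for f using subgroup.mem_carrier[OF K that] by simp
  \<comment> \<open>In order: the last leaf, giving the identity; leaves inherited from level
    \<open>k\<close>; the generators where they first occur; and the leaves handled by
    conjugation.\<close>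
  consider "i = Suc k * (n - 1)" | "i < k * (n - 1)" | "k = 0" "i < n - 1" | "k = 1" "i = n - 1"
    | "n \<le> i" "i < Suc k * (n - 1)"
  proof (cases "i = Suc k * (n - 1) \<or> i < k * (n - 1) \<or> k = 0 \<or> n \<le> i")
    case True
    have "i = Suc k * (n - 1) \<or> i < Suc k * (n - 1)" using Suc.prems by linarith
    then show ?thesis using True that by (cases "k = 0") auto
  next
    case False
    then obtain l where l: "k = Suc l" by (cases k) auto
    then have "(n - 1) + l * (n - 1) \<le> i" "i < n" using False by auto
    then have "l * (n - 1) = 0" "i = n - 1" by linarith+
    then show ?thesis using that(4) l two_le_n by simp
  qed
  then show ?case
  proof cases
    case 1
    then show ?thesis
      using leaf_map_one[OF width_expand_comb[OF Suc.prems]] subgroup.one_closed[OF K] by auto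
  next
    case 2
    then show ?thesis using Suc.IH[of i] leaf_map_comb_Suc by auto
  next
    case 3
    then show ?thesis using gen1[of i] by (simp add: numeral_2_eq_2)
  next
    case 4
    then show ?thesis using gen2 by (simp add: numeral_2_eq_2 numeral_3_eq_3)
  next
    case 5
    \<comment> \<open>Here \<open>n \<le> i\<close> ensures \<open>0 < j\<close>, so leaves 0 and
      \<open>j\<close> are distinct and their splits commute.\<close>
    define j where "j = i - (n - 1)"
    have j: "0 < j" "j < k * (n - 1)" "i = j + n - 1"
      using 5 two_le_n by (auto simp: j_def)
    obtain x0 where x0: "x0 \<in> K" "leaf_map x0 0 (expand 0 (comb k)) 0 (comb (Suc k))"
      using Suc.IH[of 0] by auto
    obtain xj where xj: "xj \<in> K" "leaf_map xj 0 (expand j (comb k)) 0 (comb (Suc k))"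
      using Suc.IH[of j] j by auto
    have l: "i < length (expand 0 (comb k))" using 5 by (simp add: length_expand)
    have w: "width (expand i (comb (Suc k))) = 1" "width (expand 0 (expand j (comb k))) = 1"
      using Suc.prems j by (simp_all add: width_expand_comb width_expand length_expand tree_width[OF tree_comb] del: comb.simps)
    have eq: "expand i (expand 0 (comb k)) = expand 0 (expand j (comb k))"
      using expand_expand[of 0 j "comb k"] j by simp
    have 1: "leaf_map x0 0 (expand 0 (expand j (comb k))) 0 (expand i (comb (Suc k)))"
      using leaf_map_expand[OF x0(2) l] by (simp only: eq)
    have 2: "leaf_map xj 0 (expand 0 (expand j (comb k))) 0 (expand 0 (comb (Suc k)))"
      by (rule leaf_map_expand[OF xj(2)]) (use j in \<open>simp add: length_expand\<close>)
    have 3: "leaf_map x0 0 (expand 0 (comb (Suc k))) 0 (comb (Suc (Suc k)))"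
      by (rule leaf_map_comb_Suc[OF _ x0(2)]) (use j in linarith)
    let ?y = "inv\<^bsub>F_group n\<^esub> x0"
    have yK: "?y \<in> K" using x0 K by (simp add: subgroup.m_inv_closed)
    have xyK: "xj \<otimes>\<^bsub>F_group n\<^esub> ?y \<in> K" using xj yK K by (simp add: subgroup.m_closed)
    \<comment> \<open>Read from right to left: \<open>inv x0\<close> undoes fact 1, then
      \<open>xj\<close> acts by 2 and \<open>x0\<close> by 3.\<close>
    have "leaf_map (x0 \<otimes>\<^bsub>F_group n\<^esub> (xj \<otimes>\<^bsub>F_group n\<^esub> ?y)) 0 (expand i (comb (Suc k))) 0 (comb (Suc (Suc k)))"
      using x0 xj yK xyK KF w
      by (intro leaf_map_mult[OF _ _ leaf_map_mult[OF _ _ leaf_map_m_inv[OF _ 1] 2] 3]) auto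
    then show ?thesis using x0 xyK K by (meson subgroup.m_closed)
  qed
qed

text \<open>Each tree is carried to a comb by an element of \<open>K\<close>: a split is transported
  along the map built so far to a split of a comb, which is then straightened. An arbitrary element
  goes from its domain tree to a comb and back to its uniform image tree.\<close>

lemma subgroup_eq_F_carrier:
  assumes K: "subgroup K (F_group n)"
    and gen1: "\<And>i. i < n - 1 \<Longrightarrow> \<exists>f\<in>K. leaf_map f 0 (expand i (comb 1)) 0 (comb 2)"
    and gen2: "\<exists>f\<in>K. leaf_map f 0 (expand (n - 1) (comb 2)) 0 (comb 3)"
  shows "K = F_carrier n"
proof -
  have KF: "f \<in> F_carrier n" if "f \<in> K" for f using subgroup.mem_carrier[OF K that] by simp
  have to_comb: "\<exists>g\<in>K. leaf_map g 0 ds 0 (comb k)" if "tree ds" "length ds = Suc (k * (n - 1))" for ds k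
    using that
  proof (induction arbitrary: k rule: tree.induct)
    case root
    then have "comb k = [0]" using two_le_n by simp
    then show ?case using leaf_map_one[of "[0]"] subgroup.one_closed[OF K] by auto
  next
    case (expand ds i)
    obtain l where l: "length ds = Suc (l * (n - 1))" using tree_length expand by blast
    then obtain g where g: "g \<in> K" "leaf_map g 0 ds 0 (comb l)" using expand by blast
    \<comment> \<open>The leaf count determines the comb, and one split raises its index by
      one.\<close>
    have "k * (n - 1) = Suc l * (n - 1)"
      using expand l two_le_n by (simp add: length_expand)
    then have k: "k = Suc l" using two_le_n by (simp only: mult_cancel2) linarith
    obtain x where x: "x \<in> K" "leaf_map x 0 (expand i (comb l)) 0 (comb k)"
      using expand_comb_to_comb[OF assms, of i l] expand l k by auto
    have "leaf_map (x \<otimes>\<^bsub>F_group n\<^esub> g) 0 (local.expand i ds) 0 (comb k)"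
      using g x expand KF leaf_map_expand tree_width[OF expand(1)] width_expand
      by (intro leaf_map_mult) auto
    then show ?case using g x K by (meson subgroup.m_closed)
  qed
  have "f \<in> K" if f: "f \<in> F_carrier n" for f
  proof -
    obtain L ds where ds: "tree ds" "leaf_map f 0 ds 0 (replicate (n ^ L) L)"
      using F_carrier_leaf_map_uniform[OF f] by blast
    obtain k where k: "length ds = Suc (k * (n - 1))" using tree_length ds by blast
    obtain g where g: "g \<in> K" "leaf_map g 0 ds 0 (comb k)" using to_comb ds k by blast
    have "length (replicate (n ^ L) L) = Suc (k * (n - 1))"
      using leaf_map_length[OF ds(2)] k by (simp only:)
    from to_comb[OF tree_uniform this]
    obtain h where h: "h \<in> K" "leaf_map h 0 (replicate (n ^ L) L) 0 (comb k)"
      by blast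
    note w = tree_width[OF ds(1)] tree_width[OF tree_uniform[of L]] tree_width[OF tree_comb[of k]]
    let ?p = "inv\<^bsub>F_group n\<^esub> h \<otimes>\<^bsub>F_group n\<^esub> g"
    have pK: "?p \<in> K" using g h K by (simp add: subgroup.m_closed subgroup.m_inv_closed)
    have "leaf_map ?p 0 ds 0 (replicate (n ^ L) L)"
      using g h K KF w by (intro leaf_map_mult[OF _ _ g(2) leaf_map_m_inv[OF _ h(2)]])
        (auto simp: subgroup.m_inv_closed)
    then have "f = ?p" using F_carrier_eqI[OF f KF[OF pK] ds(2)] w by blast
    then show ?thesis using pK by simp
  qed
  then show ?thesis using KF by blast
qed

lemma F_group_generators:
  obtains x :: "nat \<Rightarrow> real \<Rightarrow> real" where "\<And>i. i < n \<Longrightarrow> x i \<in> F_carrier n"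
    and "\<And>K. subgroup K (F_group n) \<Longrightarrow> x ` {..<n} \<subseteq> K \<Longrightarrow> K = F_carrier n"
proof -
  have "\<exists>f\<in>F_carrier n. leaf_map f 0 (expand i (comb k)) 0 (comb (Suc k))" if "i \<le> k * (n - 1)" for i k
    using that two_le_n tree_width[OF tree_comb] width_expand_comb
    by (intro F_carrier_realize) (simp_all add: length_expand del: comb.simps)
  then obtain y where y: "\<And>i k. i \<le> k * (n - 1) \<Longrightarrow>
      y i k \<in> F_carrier n \<and> leaf_map (y i k) 0 (expand i (comb k)) 0 (comb (Suc k))" by metis
  \<comment> \<open>In \<open>comb 1\<close> leaf \<open>n - 1\<close> is the last one and would
    give the identity, so the generator with this index is taken from \<open>comb 2\<close>.\<close>
  define x where "x i = (if i < n - 1 then y i 1 else y i 2)" for i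
  show thesis
  proof
    show "x i \<in> F_carrier n" if "i < n" for i
      using y[of i 1] y[of i 2] that two_le_n by (auto simp: x_def)
    fix K assume K: "subgroup K (F_group n)" "x ` {..<n} \<subseteq> K"
    show "K = F_carrier n"
    proof (rule subgroup_eq_F_carrier[OF K(1)])
      show "\<exists>f\<in>K. leaf_map f 0 (expand i (comb 1)) 0 (comb 2)" if "i < n - 1" for i
        using y[of i 1] K(2) that by (intro bexI[of _ "x i"]) (auto simp: x_def numeral_2_eq_2)
      show "\<exists>f\<in>K. leaf_map f 0 (expand (n - 1) (comb 2)) 0 (comb 3)"
        using y[of "n - 1" 2] K(2) two_le_n
        by (intro bexI[of _ "x (n - 1)"]) (auto simp: x_def numeral_2_eq_2 numeral_3_eq_3)
    qed
  qed
qed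

end

section \<open>Homomorphisms to the reals\<close>

context n_adic
begin

primrec weighted_sum :: "(nat \<Rightarrow> real) \<Rightarrow> nat \<Rightarrow> nat list \<Rightarrow> real" where
  "weighted_sum \<phi> i [] = 0"
| "weighted_sum \<phi> i (d # ds) = \<phi> (i mod (n - 1)) * real d + weighted_sum \<phi> (Suc i) ds"

text \<open>The first \<open>n - 1\<close> values of \<open>\<phi>\<close> are periodic coefficients; \<open>\<phi> (n - 1)\<close> and \<open>\<phi> n\<close> are
  additional coefficients of the first and of the last leaf.\<close>

definition weight :: "(nat \<Rightarrow> real) \<Rightarrow> nat list \<Rightarrow> real" where
  "weight \<phi> ds = weighted_sum \<phi> 0 ds + \<phi> (n - 1) * real (hd ds) + \<phi> n * real (last ds)"

lemma weighted_sum_append: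
  "weighted_sum \<phi> i (xs @ ys) = weighted_sum \<phi> i xs + weighted_sum \<phi> (i + length xs) ys"
  by (induction xs arbitrary: i) simp_all

lemma weighted_sum_shift: "weighted_sum \<phi> (i + (n - 1)) ds = weighted_sum \<phi> i ds"
proof (induction ds arbitrary: i)
  case (Cons d ds)
  show ?case using Cons[of "Suc i"] by (simp del: One_nat_def)
qed simp

lemma weighted_sum_replicate:
  "weighted_sum \<phi> i (replicate k d) = (\<Sum>j<k. \<phi> ((i + j) mod (n - 1))) * real d"
  by (induction k arbitrary: i) (simp_all add: sum.lessThan_Suc_shift algebra_simps del: sum.lessThan_Suc One_nat_def)

text \<open>Moving the window by one exchanges its first term for the one \<open>n - 1\<close>
  places later, which is equal to it.\<close>

lemma sum_period: "(\<Sum>j<n - 1. \<phi> ((i + j) mod (n - 1))) = (\<Sum>c<n - 1. \<phi> c :: real)"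
proof (induction i)
  case (Suc i)
  define g where "g j = \<phi> ((i + j) mod (n - 1))" for j
  have "(\<Sum>j<n - 1. \<phi> ((Suc i + j) mod (n - 1))) = (\<Sum>j<n - 1. g (Suc j))"
    by (simp add: g_def)
  moreover have "g 0 + (\<Sum>j<n - 1. g (Suc j)) = (\<Sum>j<n - 1. g j) + g (n - 1)"
    by (metis sum.lessThan_Suc sum.lessThan_Suc_shift)
  moreover have "g (n - 1) = g 0" by (simp add: g_def del: One_nat_def)
  ultimately show ?case using Suc by (simp add: g_def)
qed simp

text \<open>The \<open>n\<close> positions form a full period, with sum 0, and one more position of
  the residue of \<open>i\<close>.\<close>

lemma weighted_sum_caret:
  assumes "(\<Sum>c<n - 1. \<phi> c) = 0"
  shows "weighted_sum \<phi> i (replicate n d) = \<phi> (i mod (n - 1)) * real d"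
proof -
  have "(\<Sum>j<n. \<phi> ((i + j) mod (n - 1))) = (\<Sum>j<Suc (n - 1). \<phi> ((i + j) mod (n - 1)))"
    using two_le_n by simp
  also have "\<dots> = \<phi> (i mod (n - 1))"
    unfolding sum.lessThan_Suc using sum_period[of \<phi> i] assms by (simp del: One_nat_def)
  finally show ?thesis by (simp add: weighted_sum_replicate)
qed

text \<open>Expanding a leaf shifts the later ones by \<open>n - 1\<close>, so a weight that is periodic modulo
  \<open>n - 1\<close> with mean \<open>0\<close> changes by an amount that depends on the position only.\<close>

lemma weight_expand:
  assumes \<phi>: "(\<Sum>c<n - 1. \<phi> c) = 0" and i: "i < length ds"
  shows "weight \<phi> (expand i ds) = weight \<phi> ds + \<phi> (i mod (n - 1)) +
    (if i = 0 then \<phi> (n - 1) else 0) + (if Suc i = length ds then \<phi> n else 0)"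
proof -
  obtain xs d ys where ds: "ds = xs @ d # ys" "i = length xs"
    using i id_take_nth_drop[OF i] by (metis length_take less_imp_le min.absorb2)
  have e: "expand i ds = xs @ replicate n (Suc d) @ ys" using ds by simp
  have "i + n = Suc i + (n - 1)" using two_le_n by simp
  then have "weighted_sum \<phi> (i + n) ys = weighted_sum \<phi> (Suc i) ys"
    using weighted_sum_shift by metis
  then have "weighted_sum \<phi> 0 (expand i ds) = weighted_sum \<phi> 0 ds + \<phi> (i mod (n - 1))"
    using ds(2) weighted_sum_caret[OF \<phi>]
    unfolding e ds(1) by (simp add: weighted_sum_append algebra_simps)
  moreover have "hd (expand i ds) = hd ds + (if i = 0 then 1 else 0)"
    unfolding e unfolding ds by (cases xs) (simp_all add: hd_append)
  moreover have "last (expand i ds) = last ds + (if Suc i = length ds then 1 else 0)"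
    unfolding e unfolding ds by (cases "ys = []") (simp_all add: last_replicate)
  ultimately show ?thesis by (simp add: weight_def algebra_simps)
qed

text \<open>This turns vanishing of a weight difference into a linear equation in the
  \<open>n + 1\<close> coefficients.\<close>

lemma weight_linear: "weight \<phi> ds = (\<Sum>c\<le>n. \<phi> c * weight (\<lambda>j. if j = c then 1 else 0) ds)"
proof -
  have pick: "(\<Sum>c\<le>n. \<phi> c * ((if j = c then 1 else 0) * r)) = \<phi> j * r" if "j \<le> n" for j and r :: real
  proof -
    have "(\<Sum>c\<le>n. \<phi> c * ((if j = c then 1 else 0) * r)) = (\<Sum>c\<le>n. if j = c then \<phi> c * r else 0)"
      by (rule sum.cong) auto
    then show ?thesis using that by simp
  qed
  have "i mod (n - 1) \<le> n" for i
    using two_le_n mod_less_divisor[of "n - 1" i] by linarith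
  then have "weighted_sum \<phi> i ds = (\<Sum>c\<le>n. \<phi> c * weighted_sum (\<lambda>j. if j = c then 1 else 0) i ds)" for i
    by (induction ds arbitrary: i) (simp_all add: distrib_left sum.distrib pick del: One_nat_def)
  then show ?thesis
    by (simp add: weight_def distrib_left sum.distrib pick)
qed

definition weight_hom :: "(nat \<Rightarrow> real) \<Rightarrow> (real \<Rightarrow> real) \<Rightarrow> real" where
  "weight_hom \<phi> f = (THE r. \<exists>ds es. leaf_map f 0 ds 0 es \<and> width ds = 1 \<and> width es = 1 \<and>
     r = weight \<phi> ds - weight \<phi> es)"

text \<open>Splitting corresponding leaves changes both weights by the same amount. Both pairs can
  thus be refined to one uniform domain, and then \<open>f\<close> determines the image
  list.\<close>

lemma weight_diff_unique:
  assumes \<phi>: "(\<Sum>c<n - 1. \<phi> c) = 0"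
    and "leaf_map f 0 ds 0 es" "width ds = 1" "leaf_map f 0 ds' 0 es'" "width ds' = 1"
  shows "weight \<phi> ds - weight \<phi> es = weight \<phi> ds' - weight \<phi> es'"
proof -
  define L where "L = sum_list ds + sum_list ds'"
  have refine: "\<exists>as. leaf_map f 0 (replicate (n ^ L) L) 0 as \<and>
      weight \<phi> (replicate (n ^ L) L) - weight \<phi> as = weight \<phi> xs - weight \<phi> ys"
    if xs: "leaf_map f 0 xs 0 ys" "width xs = 1" "sum_list xs \<le> L" for xs ys
  proof -
    \<comment> \<open>The lists are swapped because \<open>refine_to_uniform\<close> makes its
      second list uniform, which here has to be the domain.\<close>
    let ?P = "\<lambda>bs as. leaf_map f 0 as 0 bs \<and> weight \<phi> as - weight \<phi> bs = weight \<phi> xs - weight \<phi> ys"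
    have "\<exists>bs. length bs = n ^ L \<and> ?P bs (replicate (n ^ L) L)"
    proof (rule refine_to_uniform[of ?P ys xs])
      show "\<forall>e\<in>set xs. e \<le> L"
      proof
        fix e assume "e \<in> set xs"
        then have "e \<le> sum_list xs" by (intro member_le_sum_list) simp_all
        then show "e \<le> L" using xs(3) by (rule order_trans)
      qed
      show "?P (expand i bs) (expand i as)" if "?P bs as" "length bs = length as" "i < length as" for as bs i
        using that leaf_map_expand[of f 0 as 0 bs i] weight_expand[OF \<phi>, of i as]
          weight_expand[OF \<phi>, of i bs] by simp
    qed (use xs leaf_map_length[OF xs(1)] in simp_all)
    then show ?thesis by blast
  qed
  obtain as where as: "leaf_map f 0 (replicate (n ^ L) L) 0 as"
      "weight \<phi> (replicate (n ^ L) L) - weight \<phi> as = weight \<phi> ds - weight \<phi> es"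
    using refine[OF assms(2,3)] by (auto simp: L_def)
  obtain as' where as': "leaf_map f 0 (replicate (n ^ L) L) 0 as'"
      "weight \<phi> (replicate (n ^ L) L) - weight \<phi> as' = weight \<phi> ds' - weight \<phi> es'"
    using refine[OF assms(4,5)] by (auto simp: L_def)
  show ?thesis using leaf_map_determines_codomain[OF as(1) as'(1)] as(2) as'(2) by simp
qed

lemma weight_hom_eq:
  assumes "(\<Sum>c<n - 1. \<phi> c) = 0" "leaf_map f 0 ds 0 es" "width ds = 1" "width es = 1"
  shows "weight_hom \<phi> f = weight \<phi> ds - weight \<phi> es"
  unfolding weight_hom_def
proof (rule the_equality)
  show "\<exists>ds' es'. leaf_map f 0 ds' 0 es' \<and> width ds' = 1 \<and> width es' = 1 \<and>
      weight \<phi> ds - weight \<phi> es = weight \<phi> ds' - weight \<phi> es'"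
    using assms by blast
  show "r = weight \<phi> ds - weight \<phi> es"
    if "\<exists>ds es. leaf_map f 0 ds 0 es \<and> width ds = 1 \<and> width es = 1 \<and> r = weight \<phi> ds - weight \<phi> es" for r
    using that weight_diff_unique[OF assms(1) _ _ assms(2,3)] by blast
qed

text \<open>The weight of the uniform subdivision between \<open>f\<close> and \<open>g\<close>
  cancels.\<close>

lemma weight_hom_mult:
  assumes \<phi>: "(\<Sum>c<n - 1. \<phi> c) = 0" and gf: "g \<in> F_carrier n" "f \<in> F_carrier n"
  shows "weight_hom \<phi> (g \<otimes>\<^bsub>F_group n\<^esub> f) = weight_hom \<phi> g + weight_hom \<phi> f"
proof -
  obtain L ds es where *: "tree ds" "tree es"
    "leaf_map f 0 ds 0 (replicate (n ^ L) L)" "leaf_map g 0 (replicate (n ^ L) L) 0 es"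
    using F_carrier_common_uniform[OF gf(2,1)] .
  note w = tree_width[OF *(1)] tree_width[OF *(2)] tree_width[OF tree_uniform[of L]]
  show ?thesis
    using weight_hom_eq[OF \<phi> leaf_map_mult[OF gf(2,1) *(3,4) w(1)] w(1,2)]
      weight_hom_eq[OF \<phi> *(3) w(1,3)] weight_hom_eq[OF \<phi> *(4) w(3,2)] by simp
qed

lemma weight_hom_zero_imp_weights_zero:
  assumes \<phi>: "(\<Sum>c<n - 1. \<phi> c) = 0" and zero: "\<And>f. f \<in> F_carrier n \<Longrightarrow> weight_hom \<phi> f = 0" and c: "c \<le> n"
  shows "\<phi> c = 0"
proof -
  \<comment> \<open>\<open>inc i\<close> is the weight gained by splitting leaf \<open>i\<close> of
    \<open>comb 2\<close>. Two such splits have equally many leaves, so some element maps one to the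
    other and its zero value forces equal gains.\<close>
  define inc where "inc i = \<phi> (i mod (n - 1)) + (if i = 0 then \<phi> (n - 1) else 0) +
    (if i = 2 * (n - 1) then \<phi> n else 0)" for i
  have inc_eq: "inc i = inc j" if ij: "i \<le> 2 * (n - 1)" "j \<le> 2 * (n - 1)" for i j
  proof -
    note w = width_expand_comb[OF ij(1)] width_expand_comb[OF ij(2)]
    have "length (expand i (comb 2)) = length (expand j (comb 2))"
      using ij by (simp add: length_expand del: One_nat_def)
    then obtain f where "f \<in> F_carrier n" "leaf_map f 0 (expand i (comb 2)) 0 (expand j (comb 2))"
      using F_carrier_realize w by blast
    then have "weight \<phi> (expand i (comb 2)) = weight \<phi> (expand j (comb 2))"
      using zero weight_hom_eq[OF \<phi> _ w] by fastforce
    then show ?thesis using ij by (simp add: weight_expand[OF \<phi>] inc_def del: One_nat_def)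
  qed
  have p: "0 < n - 1" "n - 1 < 2 * (n - 1)" using two_le_n by auto
  \<comment> \<open>Leaf \<open>n - 1\<close> of \<open>comb 2\<close> has residue 0 but is neither
    first nor last, so its gain is \<open>\<phi> 0\<close> alone.\<close>
  have eq: "\<phi> j = \<phi> 0" if "j < n - 1" for j
    using inc_eq[of j "n - 1"] that p by (cases "j = 0") (simp_all add: inc_def del: One_nat_def)
  have "(\<Sum>c<n - 1. \<phi> c) = (\<Sum>c<n - 1. \<phi> 0)" by (intro sum.cong refl eq) simp
  then have "\<phi> 0 = 0" using \<phi> p by simp
  then have const: "\<phi> j = 0" if "j < n - 1" for j using eq[OF that] by simp
  have "\<phi> (n - 1) = 0" using inc_eq[of 0 "n - 1"] p const[of 0] by (simp add: inc_def del: One_nat_def)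
  moreover have "\<phi> n = 0"
    using inc_eq[of "2 * (n - 1)" "n - 1"] p const[of 0] by (simp add: inc_def del: One_nat_def)
  moreover have "c < n - 1 \<or> c = n - 1 \<or> c = n" using c by linarith
  ultimately show ?thesis using const by blast
qed

end

lemma homogeneous_system_solvable:
  fixes A :: "nat \<Rightarrow> 'c \<Rightarrow> 'a::field"
  assumes "finite C" "N < card C"
  shows "\<exists>\<phi>. (\<exists>c\<in>C. \<phi> c \<noteq> 0) \<and> (\<forall>i<N. (\<Sum>c\<in>C. \<phi> c * A i c) = 0)"
  using assms
proof (induction N arbitrary: C A)
  case 0
  then show ?case by (intro exI[of _ "\<lambda>_. 1"]) (auto simp: card_gt_0_iff)
next
  case (Suc N)
  show ?case
  proof (cases "\<forall>c\<in>C. A N c = 0")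
    case True
    then show ?thesis using Suc.IH[of C A] Suc.prems by (force simp: less_Suc_eq)
  next
    case False
    then obtain b where b: "b \<in> C" "A N b \<noteq> 0" by blast
    \<comment> \<open>Gaussian elimination: equation \<open>N\<close> is used to remove the unknown
      \<open>b\<close> from the other equations.\<close>
    define B where "B i c = A i c - A i b * A N c / A N b" for i c
    have "N < card (C - {b})" using Suc.prems b by simp
    then obtain \<phi> where \<phi>: "\<exists>c\<in>C - {b}. \<phi> c \<noteq> 0" "\<And>i. i < N \<Longrightarrow> (\<Sum>c\<in>C - {b}. \<phi> c * B i c) = 0"
      using Suc.IH[of "C - {b}" B] Suc.prems by auto
    define s where "s = (\<Sum>c\<in>C - {b}. \<phi> c * A N c) / A N b"
    \<comment> \<open>The value \<open>- s\<close> at \<open>b\<close> is the one that solves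
      equation \<open>N\<close>.\<close>
    define \<psi> where "\<psi> = \<phi>(b := - s)"
    have split: "(\<Sum>c\<in>C. \<psi> c * A i c) = (\<Sum>c\<in>C - {b}. \<phi> c * A i c) - s * A i b" for i
      using Suc.prems(1) b(1) by (simp add: sum.remove[of C b] \<psi>_def)
    have "(\<Sum>c\<in>C. \<psi> c * A i c) = 0" if "i < Suc N" for i
    proof (cases "i = N")
      case True
      then show ?thesis using b by (simp add: split s_def)
    next
      case False
      then have "0 = (\<Sum>c\<in>C - {b}. \<phi> c * B i c)" using \<phi> that by simp
      also have "\<dots> = (\<Sum>c\<in>C - {b}. \<phi> c * A i c) - s * A i b"
        by (simp add: B_def s_def right_diff_distrib sum_subtractf sum_divide_distrib sum_distrib_left mult_ac)
      finally show ?thesis using split by simp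
    qed
    moreover have "\<exists>c\<in>C. \<psi> c \<noteq> 0" using \<phi>(1) by (auto simp: \<psi>_def)
    ultimately show ?thesis by blast
  qed
qed

lemma maximal_subgroup_hom_zero:
  fixes \<rho> :: "'a \<Rightarrow> real"
  assumes "group G" and M: "maximal_subgroup M G"
    and mult: "\<And>x y. x \<in> carrier G \<Longrightarrow> y \<in> carrier G \<Longrightarrow> \<rho> (x \<otimes>\<^bsub>G\<^esub> y) = \<rho> x + \<rho> y"
    and zero: "\<And>x. x \<in> M \<Longrightarrow> \<rho> x = 0" and x: "x \<in> carrier G"
  shows "\<rho> x = 0"
proof (rule ccontr)
  assume a: "\<rho> x \<noteq> 0"
  interpret group G by fact
  have one: "\<rho> \<one>\<^bsub>G\<^esub> = 0" using mult[of "\<one>\<^bsub>G\<^esub>" "\<one>\<^bsub>G\<^esub>"] by simp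
  have inv: "\<rho> (inv\<^bsub>G\<^esub> y) = - \<rho> y" if "y \<in> carrier G" for y
    using mult[of "inv\<^bsub>G\<^esub> y" y] one that by simp
  \<comment> \<open>The factor 2 keeps \<open>x\<close> out of \<open>H\<close>, while
    \<open>x \<otimes> x\<close> lies in \<open>H\<close> with the nonzero value
    \<open>2 * \<rho> x\<close> and so outside \<open>M\<close>.\<close>
  define H where "H = {y \<in> carrier G. \<exists>k::int. \<rho> y = 2 * of_int k * \<rho> x}"
  have H: "subgroup H G"
  proof (rule subgroup.intro)
    show "y \<otimes>\<^bsub>G\<^esub> z \<in> H" if yz: "y \<in> H" "z \<in> H" for y z
    proof -
      obtain k l :: int where "\<rho> y = 2 * of_int k * \<rho> x" "\<rho> z = 2 * of_int l * \<rho> x"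
        using yz by (auto simp: H_def)
      then have "\<rho> (y \<otimes>\<^bsub>G\<^esub> z) = 2 * of_int (k + l) * \<rho> x"
        using mult yz by (simp add: H_def algebra_simps)
      then show ?thesis using yz unfolding H_def by blast
    qed
    show "inv\<^bsub>G\<^esub> y \<in> H" if y: "y \<in> H" for y
    proof -
      obtain k :: int where "\<rho> y = 2 * of_int k * \<rho> x" using y by (auto simp: H_def)
      then have "\<rho> (inv\<^bsub>G\<^esub> y) = 2 * of_int (- k) * \<rho> x"
        using inv y by (simp add: H_def)
      then show ?thesis using y unfolding H_def by blast
    qed
  qed (auto simp: H_def one intro: exI[of _ 0])
  have "M \<subseteq> H"
    using M zero by (auto simp: H_def maximal_subgroup_def dest: subgroup.mem_carrier intro: exI[of _ 0])
  then consider "H = M" | "H = carrier G" using M H by (auto simp: maximal_subgroup_def)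
  then show False
  proof cases
    case 1
    have "\<rho> (x \<otimes>\<^bsub>G\<^esub> x) = 2 * of_int 1 * \<rho> x" using mult x by simp
    then have "x \<otimes>\<^bsub>G\<^esub> x \<in> H" using x unfolding H_def by blast
    then show False using 1 zero mult x a by fastforce
  next
    case 2
    then have "x \<in> H" using x by simp
    then obtain k :: int where "\<rho> x = 2 * of_int k * \<rho> x" unfolding H_def by blast
    then have "of_int 1 = (of_int (2 * k) :: real)" using a by simp
    then have "1 = 2 * k" by (simp only: of_int_eq_iff)
    then show False by presburger
  qed
qed

section \<open>Comparison of the two spaces of homomorphisms\<close>

theorem lemma3p1:
  fixes m n :: nat
  assumes "m \<ge> 2" and "n \<ge> 2"
    and "\<exists>M. maximal_subgroup M (F_group m) \<and> (F_group m)\<lparr>carrier := M\<rparr> \<cong> F_group n"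
  shows "n \<ge> m"
proof (rule ccontr)
  assume "\<not> n \<ge> m"
  interpret Fm: n_adic m by unfold_locales fact
  interpret Fn: n_adic n by unfold_locales fact
  interpret gm: group "F_group m" by (rule Fm.group_F_group)
  interpret gn: group "F_group n" by (rule Fn.group_F_group)
  obtain M where M: "maximal_subgroup M (F_group m)" and iso: "(F_group m)\<lparr>carrier := M\<rparr> \<cong> F_group n"
    using assms(3) by blast
  have sub: "subgroup M (F_group m)" using M by (simp add: maximal_subgroup_def)
  have MF: "f \<in> F_carrier m" if "f \<in> M" for f using subgroup.mem_carrier[OF sub that] by simp
  have "group ((F_group m)\<lparr>carrier := M\<rparr>)"
    by (rule subgroup.subgroup_is_group[OF sub gm.is_group])
  from group.iso_sym[OF this iso] obtain \<theta>
    where \<theta>: "\<theta> \<in> iso (F_group n) ((F_group m)\<lparr>carrier := M\<rparr>)"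
    by (auto simp: is_iso_def)
  then have bij: "\<theta> ` F_carrier n = M" by (simp add: iso_def bij_betw_def)
  have hom: "\<theta> (f \<otimes>\<^bsub>F_group n\<^esub> g) = \<theta> f \<otimes>\<^bsub>F_group m\<^esub> \<theta> g"
    if "f \<in> F_carrier n" "g \<in> F_carrier n" for f g
    using \<theta> that by (simp add: iso_def hom_def)
  have \<theta>F: "\<theta> f \<in> F_carrier m" if "f \<in> F_carrier n" for f using bij that MF by blast
  obtain x where x: "\<And>i. i < n \<Longrightarrow> x i \<in> F_carrier n"
    and gen: "\<And>K. subgroup K (F_group n) \<Longrightarrow> x ` {..<n} \<subseteq> K \<Longrightarrow> K = F_carrier n"
    using Fn.F_group_generators by blast
  have "\<exists>ds es. Fm.leaf_map (\<theta> (x i)) 0 ds 0 es \<and> Fm.width ds = 1 \<and> Fm.width es = 1" if "i < n" for i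
    using Fm.F_carrier_leaf_map_uniform[OF \<theta>F[OF x[OF that]]] Fm.tree_width Fm.tree_uniform by blast
  then obtain ds es where lm: "\<And>i. i < n \<Longrightarrow> Fm.leaf_map (\<theta> (x i)) 0 (ds i) 0 (es i)"
    "\<And>i. i < n \<Longrightarrow> Fm.width (ds i) = 1" "\<And>i. i < n \<Longrightarrow> Fm.width (es i) = 1" by metis
  define E where "E c = (\<lambda>j. if j = c then 1 else 0 :: real)" for c :: nat
  \<comment> \<open>Rows \<open>i < n\<close> express that the weight homomorphism vanishes on the
    image of generator \<open>i\<close>; row \<open>n\<close> is the zero-sum condition. These are
    \<open>n + 1\<close> equations in \<open>m + 1\<close> unknowns, and
    \<open>n < m\<close>.\<close>
  define A where "A i c = (if i = n then if c < m - 1 then 1 else 0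
    else Fm.weight (E c) (ds i) - Fm.weight (E c) (es i))" for i c
  obtain \<phi> where \<phi>: "\<exists>c\<in>{..m}. \<phi> c \<noteq> 0" "\<And>i. i < Suc n \<Longrightarrow> (\<Sum>c\<le>m. \<phi> c * A i c) = 0"
    using homogeneous_system_solvable[of "{..m}" "Suc n" A] \<open>\<not> n \<ge> m\<close> by auto
  have "0 = (\<Sum>c\<le>m. \<phi> c * A n c)" using \<phi>(2)[of n] by simp
  also have "\<dots> = (\<Sum>c\<le>m. if c < m - 1 then \<phi> c else 0)"
    by (rule sum.cong) (simp_all add: A_def)
  also have "\<dots> = (\<Sum>c<m - 1. \<phi> c)"
    by (rule sum.mono_neutral_cong_right) auto
  finally have sum0: "(\<Sum>c<m - 1. \<phi> c) = 0" by simp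
  have x0: "Fm.weight_hom \<phi> (\<theta> (x i)) = 0" if i: "i < n" for i
  proof -
    have "Fm.weight_hom \<phi> (\<theta> (x i)) = Fm.weight \<phi> (ds i) - Fm.weight \<phi> (es i)"
      using Fm.weight_hom_eq[OF sum0] lm i by blast
    also have "\<dots> = (\<Sum>c\<le>m. \<phi> c * A i c)"
      using i by (subst (1 2) Fm.weight_linear) (simp add: A_def E_def right_diff_distrib sum_subtractf)
    finally show ?thesis using \<phi>(2)[of i] i by simp
  qed
  define \<rho> where "\<rho> f = Fm.weight_hom \<phi> (\<theta> f)" for f
  have mult: "\<rho> (f \<otimes>\<^bsub>F_group n\<^esub> g) = \<rho> f + \<rho> g" if "f \<in> F_carrier n" "g \<in> F_carrier n" for f g
    using that by (simp add: \<rho>_def hom Fm.weight_hom_mult[OF sum0] \<theta>F)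
  have one: "\<rho> \<one>\<^bsub>F_group n\<^esub> = 0"
    using mult[of "\<one>\<^bsub>F_group n\<^esub>" "\<one>\<^bsub>F_group n\<^esub>"] gn.one_closed by simp
  have inv: "\<rho> (inv\<^bsub>F_group n\<^esub> f) = - \<rho> f" if "f \<in> F_carrier n" for f
    using mult[of "inv\<^bsub>F_group n\<^esub> f" f] one that gn.inv_closed[of f] gn.l_inv[of f] by simp
  \<comment> \<open>The kernel of \<open>\<rho>\<close> is a subgroup containing the generators,
    hence everything.\<close>
  have "{f \<in> F_carrier n. \<rho> f = 0} = F_carrier n"
  proof (rule gen)
    show "subgroup {f \<in> F_carrier n. \<rho> f = 0} (F_group n)"
      using gn.m_closed gn.inv_closed gn.one_closed mult one inv
      by (intro subgroup.intro) simp_all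
    show "x ` {..<n} \<subseteq> {f \<in> F_carrier n. \<rho> f = 0}"
      using x x0 by (auto simp: \<rho>_def)
  qed
  then have zero: "Fm.weight_hom \<phi> f = 0" if "f \<in> M" for f
    using that bij by (auto simp: \<rho>_def)
  have "Fm.weight_hom \<phi> f = 0" if "f \<in> F_carrier m" for f
  proof (rule maximal_subgroup_hom_zero[where \<rho> = "Fm.weight_hom \<phi>", OF gm.is_group M])
    show "Fm.weight_hom \<phi> (g \<otimes>\<^bsub>F_group m\<^esub> h) = Fm.weight_hom \<phi> g + Fm.weight_hom \<phi> h"
      if "g \<in> carrier (F_group m)" "h \<in> carrier (F_group m)" for g h
      using that by (simp add: Fm.weight_hom_mult[OF sum0])
  qed (use that zero in simp_all)
  then show False
    using Fm.weight_hom_zero_imp_weights_zero[OF sum0] \<phi>(1) by (meson atMost_iff)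
qed

end
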